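(* Let $\lambda\in\mathbb{C}$ and suppose that $R_\lambda$ is convex (in the usual sense). Then: (1) if $\lambda\in[0,1]$, then $R_\lambda=[0,1]$; (2) if $\lambda\in\mathbb{R}\setminus[0,1]$, then $R_\lambda=\mathbb{R}$; (3) if $\lambda\in\mathbb{C}\setminus\mathbb{R}$, then $R_\lambda=\mathbb{C}$.
   Context: For $\lambda\in\mathbb{C}$, a set $S\subseteq\mathbb{C}$ is $\lambda$-convex if for all $a,b\in S$ the point $(1-\lambda)a+\lambda b$ is in $S$; it is $\lambda$-clonvex if it is $\lambda$-convex and topologically closed in $\mathbb{C}$. $R_\lambda$ denotes the smallest (with respect to $\subseteq$) $\lambda$-clonvex set containing $\{0,1\}$. *)

theory Defs
  imports "HOL-Analysis.Analysis"
begin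

definition lconvex :: "complex \<Rightarrow> complex set \<Rightarrow> bool" where
  "lconvex l S \<longleftrightarrow> (\<forall>a\<in>S. \<forall>b\<in>S. (1 - l) * a + l * b \<in> S)"

definition lclonvex :: "complex \<Rightarrow> complex set \<Rightarrow> bool" where
  "lclonvex l S \<longleftrightarrow> lconvex l S \<and> closed S"

definition R :: "complex \<Rightarrow> complex set" where
  "R l = lclonvex l hull {0, 1}"

text \<open>The hull is the intersection of all \<open>\<lambda>\<close>-clonvex sets containing \<open>{0, 1}\<close>;
  the next two facts show that it is itself \<open>\<lambda>\<close>-clonvex, hence the smallest such set.\<close>

lemma lclonvex_Inter:
  assumes "\<And>S. S \<in> F \<Longrightarrow> lclonvex l S"
  shows "lclonvex l (\<Inter>F)"
  using assms unfolding lclonvex_def lconvex_def by (simp add: closed_Inter)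

lemma R_least:
  "lclonvex l (R l)"
  "{0, 1} \<subseteq> R l"
  "lclonvex l S \<Longrightarrow> {0, 1} \<subseteq> S \<Longrightarrow> R l \<subseteq> S"
proof -
  show "lclonvex l (R l)"
    unfolding R_def by (rule hull_in) (rule lclonvex_Inter, blast)
  show "{0, 1} \<subseteq> R l"
    unfolding R_def by (rule hull_subset)
  show "R l \<subseteq> S" if "lclonvex l S" "{0, 1} \<subseteq> S"
    unfolding R_def using that(2,1) by (rule hull_minimal)
qed

definition unit_interval :: "complex set" where
  "unit_interval = complex_of_real ` {0..1}"

end

theory Submission
  imports Defs
begin

text \<open>The set \<open>R \<lambda>\<close> contains \<open>p + \<lambda>\<^sup>k (b - p)\<close> along with any points \<open>p\<close> and \<open>b\<close>. For real
  \<open>\<lambda> > 1\<close> this puts \<open>\<lambda>\<^sup>k\<close> and \<open>1 - \<lambda>\<^sup>k\<close> into \<open>R \<lambda>\<close>, and real \<open>\<lambda> < 0\<close> reduces to this case because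
  \<open>\<lambda>\<close>- and \<open>(1 - \<lambda>)\<close>-convexity agree. For non-real \<open>\<lambda>\<close>, a point outside the closed convex set
  \<open>R \<lambda>\<close> yields a supporting line at its nearest point \<open>p\<close>, so that all \<open>\<lambda>\<^sup>k (b - p)\<close> lie in one
  closed half-plane through the origin; but the rotating directions of the powers of \<open>\<lambda>\<close> cannot
  avoid an open half-plane.\<close>

lemma lconvex_one_minus: "lconvex (1 - l) S \<longleftrightarrow> lconvex l S"
  unfolding lconvex_def by (auto simp: add.commute)

text \<open>The map sending \<open>x\<close> to \<open>(1 - l) * p + l * x\<close> fixes
  \<open>p\<close> and multiplies differences from \<open>p\<close> by \<open>l\<close>; iterating
  it from \<open>b\<close> gives the powers.\<close>

lemma lconvex_power:
  assumes "lconvex l S" "p \<in> S" "b \<in> S"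
  shows "p + l ^ k * (b - p) \<in> S"
proof (induction k)
  case 0
  then show ?case using assms by simp
next
  case (Suc k)
  have "(1 - l) * p + l * (p + l ^ k * (b - p)) \<in> S"
    using assms Suc unfolding lconvex_def by blast
  then show ?case by (simp add: algebra_simps)
qed

lemma convex_of_real_mem:
  fixes S :: "complex set"
  assumes "convex S" "of_real a \<in> S" "of_real b \<in> S" "a \<le> x" "x \<le> b"
  shows "of_real x \<in> S"
proof -
  have "x \<in> closed_segment a b"
    using assms by (simp add: closed_segment_eq_real_ivl)
  then have "of_real x \<in> closed_segment (complex_of_real a) (of_real b)"
    by (simp add: of_real_closed_segment)
  then show ?thesis
    using assms closed_segment_subset by blast
qed

lemma Reals_subset_lconvex:
  fixes m :: real
  assumes "lconvex (of_real m) S" "convex S" "0 \<in> S" "1 \<in> S" "m > 1"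
  shows "\<real> \<subseteq> S"
proof
  fix z :: complex assume "z \<in> \<real>"
  then obtain x where z: "z = of_real x" by (elim Reals_cases)
  \<comment> \<open>The extra 1 leaves room for the lower bound \<open>1 - m ^ k\<close>, which must
    also lie below \<open>x\<close>.\<close>
  obtain k where k: "\<bar>x\<bar> + 1 < m ^ k"
    using real_arch_pow \<open>m > 1\<close> by blast
  have "of_real (m ^ k) \<in> S"
    using lconvex_power[OF assms(1,3,4), of k] by simp
  moreover have "of_real (1 - m ^ k) \<in> S"
    using lconvex_power[OF assms(1,4,3), of k] by simp
  moreover have "1 - m ^ k \<le> x" "x \<le> m ^ k"
    using k by linarith+
  ultimately show "z \<in> S"
    unfolding z using convex_of_real_mem[OF \<open>convex S\<close>] by blast
qed

text \<open>Otherwise the terms \<open>- Re (c * z ^ k)\<close> are nonnegative with bounded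
  geometric partial sums, so they are summable and tend to 0. The imaginary parts follow, although
  \<open>c * z ^ k\<close> has constant norm \<open>norm c > 0\<close>.\<close>

lemma unit_powers_leave_half_plane:
  fixes z c :: complex
  assumes z: "norm z = 1" "Im z \<noteq> 0" and c: "c \<noteq> 0"
  shows "\<exists>k. Re (c * z ^ k) > 0"
proof (rule ccontr)
  assume "\<not> ?thesis"
  then have nonneg: "0 \<le> - Re (c * z ^ k)" for k
    by (simp add: not_less)
  have z1: "z \<noteq> 1" using z by auto
  have bound: "(\<Sum>k<n. - Re (c * z ^ k)) \<le> norm c * 2 / norm (1 - z)" for n
  proof -
    have "(\<Sum>k<n. - Re (c * z ^ k)) = - Re (c * (\<Sum>k<n. z ^ k))"
      by (simp only: sum_negf Re_sum[symmetric] sum_distrib_left)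
    also have "\<dots> \<le> norm (c * (\<Sum>k<n. z ^ k))"
      using abs_Re_le_cmod abs_le_D2 by blast
    also have "\<dots> = norm c * norm (1 - z ^ n) / norm (1 - z)"
      using z1 by (simp add: sum_gp_strict norm_mult norm_divide)
    also have "\<dots> \<le> norm c * 2 / norm (1 - z)"
      using norm_triangle_ineq4[of 1 "z ^ n"] z
      by (intro divide_right_mono mult_left_mono) (auto simp: norm_power)
    finally show ?thesis .
  qed
  have "summable (\<lambda>k. - Re (c * z ^ k))"
    by (rule summableI_nonneg_bounded[OF nonneg bound])
  then have re: "(\<lambda>k. Re (c * z ^ k)) \<longlonglongrightarrow> 0"
    using tendsto_minus[OF summable_LIMSEQ_zero] by force
  \<comment> \<open>The real parts of two consecutive terms determine the imaginary part of the first.\<close>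
  have "(\<lambda>k. (Re z * Re (c * z ^ k) - Re (c * z ^ Suc k)) / Im z) \<longlonglongrightarrow> (Re z * 0 - 0) / Im z"
    using z by (intro tendsto_intros re LIMSEQ_Suc[OF re]) auto
  moreover have "(Re z * Re (c * z ^ k) - Re (c * z ^ Suc k)) / Im z = Im (c * z ^ k)" for k
    using z by (simp add: field_simps)
  ultimately have "(\<lambda>k. Im (c * z ^ k)) \<longlonglongrightarrow> 0" by simp
  with re have "(\<lambda>k. c * z ^ k) \<longlonglongrightarrow> 0"
    by (simp add: tendsto_complex_iff)
  then have "(\<lambda>k. norm (c * z ^ k)) \<longlonglongrightarrow> 0"
    by (rule tendsto_norm_zero)
  then show False
    using z c by (simp add: norm_mult norm_power LIMSEQ_const_iff)
qed

text \<open>Passing from \<open>l\<close> to \<open>sgn l\<close> only divides the k-th term by the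
  positive real \<open>norm l ^ k\<close>, which preserves the sign of the real part.\<close>

lemma powers_leave_half_plane:
  fixes l c :: complex
  assumes "l \<notin> \<real>" "c \<noteq> 0"
  shows "\<exists>k. Re (c * l ^ k) > 0"
proof -
  have l: "l \<noteq> 0" "Im l \<noteq> 0" using assms by (auto simp: complex_is_Real_iff)
  then obtain k where k: "Re (c * sgn l ^ k) > 0"
    using unit_powers_leave_half_plane[of "sgn l" c] assms by (auto simp: norm_sgn)
  have "c * l ^ k = of_real (norm l ^ k) * (c * sgn l ^ k)"
    using l by (simp add: sgn_eq power_divide)
  then have "Re (c * l ^ k) = norm l ^ k * Re (c * sgn l ^ k)"
    by (simp only: Re_complex_of_real Im_complex_of_real times_complex.sel(1) mult_zero_left diff_zero)
  then show ?thesis using k l by (intro exI[of _ k]) simp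
qed

lemma lclonvex_convex_eq_UNIV:
  assumes "lclonvex l S" "convex S" "a \<in> S" "b \<in> S" "a \<noteq> b" "l \<notin> \<real>"
  shows "S = UNIV"
proof (rule ccontr)
  assume "S \<noteq> UNIV"
  then obtain y where y: "y \<notin> S" by blast
  have S: "lconvex l S" "closed S" using assms by (auto simp: lclonvex_def)
  define p where "p = closest_point S y"
  have p: "p \<in> S"
    unfolding p_def using S assms(3) by (intro closest_point_in_set) auto
  obtain d where d: "d \<in> S" "d \<noteq> p" using assms(3-5) by metis
  \<comment> \<open>\<open>Re (cnj u * v)\<close> is the real inner product of \<open>u\<close> and
    \<open>v\<close>, so a positive value for some power contradicts the obtuse angle at the closest
    point \<open>p\<close>.\<close>
  have "cnj (y - p) * (d - p) \<noteq> 0" using p y d by auto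
  then obtain k where "Re (cnj (y - p) * (d - p) * l ^ k) > 0"
    using powers_leave_half_plane[OF assms(6)] by blast
  moreover have "inner (y - p) ((p + l ^ k * (d - p)) - p) \<le> 0"
    unfolding p_def
    by (intro closest_point_dot[OF \<open>convex S\<close> S(2)] lconvex_power[OF S(1)] p[unfolded p_def] d)
  ultimately show False
    by (simp add: inner_complex_def algebra_simps)
qed

lemma lclonvex_unit_interval:
  assumes "l \<in> unit_interval"
  shows "lclonvex l unit_interval"
proof -
  have "lconvex l unit_interval"
    unfolding lconvex_def
  proof (intro ballI)
    fix a b assume "a \<in> unit_interval" "b \<in> unit_interval"
    then obtain x y t where *: "a = of_real x" "b = of_real y" "l = of_real t"
        "x \<in> {0..1}" "y \<in> {0..1}" "t \<in> {0..1}"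
      using assms by (auto simp: unit_interval_def)
    have "(1 - t) * x + t * y \<in> {0..1}"
      using convexD[OF convex_real_interval(5), of x 0 1 y "1 - t" t] * by simp
    moreover have "(1 - l) * a + l * b = of_real ((1 - t) * x + t * y)"
      using * by simp
    ultimately show "(1 - l) * a + l * b \<in> unit_interval"
      unfolding unit_interval_def by blast
  qed
  moreover have "closed unit_interval"
    unfolding unit_interval_def
    by (intro compact_imp_closed compact_continuous_image continuous_intros) simp
  ultimately show ?thesis by (simp add: lclonvex_def)
qed

lemma lclonvex_Reals:
  assumes "l \<in> \<real>"
  shows "lclonvex l \<real>"
  using assms by (simp add: lclonvex_def lconvex_def closed_complex_Reals)

theorem theorem2p19:
  fixes l :: complex
  assumes "convex (R l)"
  shows "(l \<in> unit_interval \<longrightarrow> R l = unit_interval)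
       \<and> (l \<in> \<real> - unit_interval \<longrightarrow> R l = \<real>)
       \<and> (l \<notin> \<real> \<longrightarrow> R l = UNIV)"
proof (intro conjI impI)
  have mem: "0 \<in> R l" "1 \<in> R l" using R_least(2) by auto
  have lconvex: "lconvex l (R l)" using R_least(1) by (simp add: lclonvex_def)
  show "R l = unit_interval" if "l \<in> unit_interval"
  proof
    show "R l \<subseteq> unit_interval"
      using that by (intro R_least(3) lclonvex_unit_interval) (auto simp: unit_interval_def image_iff)
    show "unit_interval \<subseteq> R l"
      unfolding unit_interval_def using convex_of_real_mem[OF assms, of 0 1] mem by auto
  qed
  show "R l = \<real>" if l: "l \<in> \<real> - unit_interval"
  proof
    show "R l \<subseteq> \<real>"
      using that by (intro R_least(3) lclonvex_Reals) auto
    obtain x where x: "l = of_real x" using l by (auto elim: Reals_cases)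
    with l consider "x > 1" | "1 - x > 1"
      by (force simp: unit_interval_def)
    then show "\<real> \<subseteq> R l"
    proof cases
      case 1
      then show ?thesis
        using Reals_subset_lconvex[OF _ assms mem] lconvex x by simp
    next
      case 2
      then show ?thesis
        using Reals_subset_lconvex[of "1 - x", OF _ assms mem] lconvex x by (simp add: lconvex_one_minus)
    qed
  qed
  show "R l = UNIV" if "l \<notin> \<real>"
    using lclonvex_convex_eq_UNIV[OF R_least(1) assms mem _ that] by simp
qed

end
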